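(* Let $n\ge 2$, let $a\in C_n\cap\mathbb{R}^n_{\ge 0}$ with $\prod_{i=1}^n a_i\ge 1$, and let $(p^k)_{k\ge 0}$ be a sequence of iterates generated by the composite-step algorithm from an initial iterate $p^0\in \mathrm{sl}(n)\cap\mathbb{R}^n_{\ge 0}$. Then, for every $k$, $p^k\in C_n$ implies $p^{k+1}\in C_n$.
   Context: $\mathbb{R}^n_{\ge 0}=\{x\in\mathbb{R}^n : x_i\ge 0 \text{ for all } i\}$, $\mathrm{sl}(n)=\{x\in\mathbb{R}^n : \prod_{i=1}^n x_i=1\}$, and the order cone is $C_n=\{x\in\mathbb{R}^n : x_1\ge x_2\ge\dots\ge x_n\}$. For a vector $p$ with nonzero entries, $p^{-1}=(p_1^{-1},\dots,p_n^{-1})^T$. Composite-step algorithm: given $a\in\mathbb{R}^n_{\ge 0}$ and $p^0\in \mathrm{sl}(n)\cap\mathbb{R}^n_{\ge 0}$, for $k=0,1,2,\dots$ set $d^k=(p^k)^{-1}$, let $t^k$ be the unique real number such that $a+t^kd^k\in \mathrm{sl}(n)\cap\mathbb{R}^n_{\ge 0}$, and set $p^{k+1}=a+t^kd^k$. *)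

theory Defs
  imports "HOL-Analysis.Analysis"
begin

text \<open>
  Vectors are indexed by an arbitrary finite linearly ordered type \<open>'n\<close>: its elements, listed in
  increasing order, are the indices \<open>1, \<dots>, n\<close> with \<open>n = CARD('n)\<close>.
\<close>

definition nonneg_orthant :: "(real ^ 'n) set" where
  "nonneg_orthant = {x. \<forall>i. x $ i \<ge> 0}"

definition sl :: "(real ^ 'n) set" where
  "sl = {x. (\<Prod>i\<in>UNIV. x $ i) = 1}"

definition order_cone :: "(real ^ 'n::{finite,linorder}) set" where
  "order_cone = {x. \<forall>i j. i \<le> j \<longrightarrow> x $ i \<ge> x $ j}"

definition vec_inverse :: "real ^ 'n \<Rightarrow> real ^ 'n" where
  "vec_inverse p = (\<chi> i. inverse (p $ i))"

text \<open>
  For \<open>a \<in> nonneg_orthant\<close> and \<open>d\<close> with positive entries, the number described below exists and is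
  unique; outside that case its value is unspecified.
\<close>

definition step_length :: "real ^ 'n \<Rightarrow> real ^ 'n \<Rightarrow> real" where
  "step_length a d = (THE t. a + t *\<^sub>R d \<in> sl \<inter> nonneg_orthant)"

definition composite_step :: "real ^ 'n \<Rightarrow> real ^ 'n \<Rightarrow> real ^ 'n" where
  "composite_step a p = (let d = vec_inverse p in a + step_length a d *\<^sub>R d)"

primrec composite_iterate :: "real ^ 'n \<Rightarrow> real ^ 'n \<Rightarrow> nat \<Rightarrow> real ^ 'n" where
  "composite_iterate a p0 0 = p0"
| "composite_iterate a p0 (Suc k) = composite_step a (composite_iterate a p0 k)"

end

(* Along the ray t \<mapsto> a + t d with d > 0 the product of the coordinates is strictly increasing
   inside the nonnegative orthant. It vanishes where the ray leaves the orthant and is at least 1 at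
   t = 0, so the step length is nonpositive. If p is decreasing, then d = 1/p is increasing, and
   adding a nonpositive multiple of d to the decreasing vector a keeps it decreasing. *)
theory Submission
  imports Defs
begin

text \<open>Ensures that \<open>vec_inverse\<close> only meets nonzero entries, never the default
  value \<open>inverse 0 = 0\<close>, and yields a positive direction.\<close>

lemma sl_nonneg_pos:
  assumes "x \<in> sl \<inter> nonneg_orthant"
  shows "x $ i > 0"
proof -
  have "(\<Prod>j\<in>UNIV. x $ j) \<noteq> 0"
    using assms by (simp add: sl_def)
  then have "x $ i \<noteq> 0"
    by (simp add: prod_zero_iff)
  moreover have "x $ i \<ge> 0"
    using assms by (simp add: nonneg_orthant_def)
  ultimately show ?thesis
    by simp
qed

lemma vec_inverse_nth [simp]: "vec_inverse p $ i = inverse (p $ i)"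
  by (simp add: vec_inverse_def)

lemma prod_ray_strict_mono:
  fixes a d :: "real ^ 'n"
  assumes "\<And>i. d $ i > 0" and "a + s *\<^sub>R d \<in> nonneg_orthant" and "s < t"
  shows "(\<Prod>i\<in>UNIV. (a + s *\<^sub>R d) $ i) < (\<Prod>i\<in>UNIV. (a + t *\<^sub>R d) $ i)"
proof -
  have less: "(a + s *\<^sub>R d) $ i < (a + t *\<^sub>R d) $ i" for i
    using assms(1,3) by simp
  have nonneg: "0 \<le> (a + s *\<^sub>R d) $ i" for i
    using assms(2) unfolding nonneg_orthant_def by blast
  have pos: "0 < (a + t *\<^sub>R d) $ i" for i
    using less[of i] nonneg[of i] by linarith
  show ?thesis
    \<comment> \<open>The rule asks for one index with a strict inequality. Every index qualifies,
      so the arbitrary element \<open>undefined\<close> serves.\<close>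
    by (rule prod_mono_strict[of undefined]) (use less nonneg pos in \<open>auto intro: less_imp_le\<close>)
qed

lemma ex1_step_length:
  fixes a d :: "real ^ 'n"
  assumes d: "\<And>i. d $ i > 0" and a: "a \<in> nonneg_orthant" and prod_a: "(\<Prod>i\<in>UNIV. a $ i) \<ge> 1"
  shows "\<exists>!t. a + t *\<^sub>R d \<in> sl \<inter> nonneg_orthant"
proof -
  let ?f = "\<lambda>t. \<Prod>i\<in>UNIV. (a + t *\<^sub>R d) $ i"
  \<comment> \<open>Coordinate i of the ray is nonnegative iff t is at least
    \<open>- (a $ i / d $ i)\<close>, so \<open>- m\<close> is the parameter at which the ray enters
    the orthant.\<close>
  define m where "m = Min (range (\<lambda>i. a $ i / d $ i))"
  have m_le: "m \<le> a $ i / d $ i" for i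
    unfolding m_def by (rule Min_le) auto
  have "m \<in> range (\<lambda>i. a $ i / d $ i)"
    unfolding m_def by (rule Min_in) auto
  then obtain k where k: "m = a $ k / d $ k"
    by blast
  have m_nonneg: "m \<ge> 0"
    using k a d[of k] by (simp add: nonneg_orthant_def)
  have nonneg: "a + t *\<^sub>R d \<in> nonneg_orthant" if "- m \<le> t" for t
  proof -
    have "0 \<le> a $ i + t * d $ i" for i
    proof -
      have "- t \<le> a $ i / d $ i"
        using that m_le[of i] by linarith
      then show ?thesis
        using d[of i] by (simp add: pos_le_divide_eq)
    qed
    then show ?thesis
      by (simp add: nonneg_orthant_def)
  qed
  have "(a + (- m) *\<^sub>R d) $ k = 0"
    using k d[of k] by simp
  then have zero: "?f (- m) = 0"
    by (intro prod_zero) auto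
  \<comment> \<open>Intermediate values: the product is 0 at \<open>- m\<close>, and at 0 it is that
    of \<open>a\<close>, hence at least 1.\<close>
  have "\<exists>t\<ge>- m. t \<le> 0 \<and> ?f t = 1"
  proof (rule IVT')
    show "?f (- m) \<le> 1"
      by (subst zero) simp
    show "continuous_on {- m..0} ?f"
      by (intro continuous_intros)
  qed (use prod_a m_nonneg in auto)
  then obtain t where "- m \<le> t" "?f t = 1"
    by blast
  then have "a + t *\<^sub>R d \<in> sl \<inter> nonneg_orthant"
    using nonneg by (simp add: sl_def)
  then show ?thesis
  proof (rule ex1I)
    fix s
    assume "a + s *\<^sub>R d \<in> sl \<inter> nonneg_orthant"
    \<comment> \<open>Both points have product 1, while strict monotonicity from the smaller
      parameter would make the products differ.\<close>
    with \<open>a + t *\<^sub>R d \<in> sl \<inter> nonneg_orthant\<close> show "s = t"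
      using prod_ray_strict_mono[OF d, of a s t] prod_ray_strict_mono[OF d, of a t s]
      by (cases s t rule: linorder_cases) (auto simp: sl_def)
  qed
qed

lemma step_length_in:
  fixes a d :: "real ^ 'n"
  assumes "\<And>i. d $ i > 0" "a \<in> nonneg_orthant" "(\<Prod>i\<in>UNIV. a $ i) \<ge> 1"
  shows "a + step_length a d *\<^sub>R d \<in> sl \<inter> nonneg_orthant"
  unfolding step_length_def by (rule theI', rule ex1_step_length[OF assms])

lemma step_length_nonpos:
  fixes a d :: "real ^ 'n"
  assumes d: "\<And>i. d $ i > 0" and a: "a \<in> nonneg_orthant" and prod_a: "(\<Prod>i\<in>UNIV. a $ i) \<ge> 1"
  shows "step_length a d \<le> 0"
proof (rule ccontr)
  assume "\<not> step_length a d \<le> 0"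
  then have "(\<Prod>i\<in>UNIV. a $ i) < (\<Prod>i\<in>UNIV. (a + step_length a d *\<^sub>R d) $ i)"
    using prod_ray_strict_mono[OF d, of a 0 "step_length a d"] a by simp
  also have "\<dots> = 1"
    using step_length_in[OF assms] by (simp add: sl_def)
  finally show False
    using prod_a by simp
qed

text \<open>This invariant keeps every iterate positive, so that each new direction is positive and
  the step length is well defined.\<close>

lemma composite_iterate_in:
  fixes a p0 :: "real ^ 'n"
  assumes "a \<in> nonneg_orthant" "(\<Prod>i\<in>UNIV. a $ i) \<ge> 1" "p0 \<in> sl \<inter> nonneg_orthant"
  shows "composite_iterate a p0 k \<in> sl \<inter> nonneg_orthant"
proof (induction k)
  case 0
  show ?case
    using assms(3) by simp
next
  case (Suc k)
  show ?case
    using step_length_in[OF _ assms(1,2)] sl_nonneg_pos[OF Suc]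
    by (simp add: composite_step_def Let_def)
qed

lemma composite_step_in_order_cone:
  fixes a p :: "real ^ 'n::{finite,linorder}"
  assumes a: "a \<in> order_cone" "a \<in> nonneg_orthant" "(\<Prod>i\<in>UNIV. a $ i) \<ge> 1"
    and p: "\<And>i. p $ i > 0" "p \<in> order_cone"
  shows "composite_step a p \<in> order_cone"
proof -
  let ?t = "step_length a (vec_inverse p)"
  have t: "?t \<le> 0"
    using p(1) by (intro step_length_nonpos a) simp
  have "a $ j + ?t * inverse (p $ j) \<le> a $ i + ?t * inverse (p $ i)" if "i \<le> j" for i j
  proof (rule add_mono)
    show "a $ j \<le> a $ i"
      using a(1) that by (simp add: order_cone_def)
    \<comment> \<open>Inversion reverses the order only between numbers of the same sign, hence the
      positivity of \<open>p\<close>.\<close>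
    have "inverse (p $ i) \<le> inverse (p $ j)"
      using p that by (intro le_imp_inverse_le) (auto simp: order_cone_def)
    then show "?t * inverse (p $ j) \<le> ?t * inverse (p $ i)"
      using t by (rule mult_left_mono_neg)
  qed
  then show ?thesis
    by (simp add: composite_step_def Let_def order_cone_def)
qed

theorem lemma5p2:
  fixes a p0 :: "real ^ 'n::{finite,linorder}"
  assumes "CARD('n) \<ge> 2"
    and "a \<in> order_cone \<inter> nonneg_orthant"
    and "(\<Prod>i\<in>UNIV. a $ i) \<ge> 1"
    and "p0 \<in> sl \<inter> nonneg_orthant"
  shows "\<forall>k. composite_iterate a p0 k \<in> order_cone \<longrightarrow> composite_iterate a p0 (Suc k) \<in> order_cone"
proof (intro allI impI)
  fix k
  assume "composite_iterate a p0 k \<in> order_cone"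
  \<comment> \<open>Membership in the cone says nothing about signs; positivity comes from the
    invariant.\<close>
  moreover have "composite_iterate a p0 k $ i > 0" for i
    using assms by (intro sl_nonneg_pos composite_iterate_in) auto
  ultimately show "composite_iterate a p0 (Suc k) \<in> order_cone"
    using assms by (simp add: composite_step_in_order_cone)
qed

end
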